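(* Let $p,q\in(0,1)$ with $p+q\le1$, let $n\in\mathbb{N}$, and let $(M,K,n-M-K)$ be a multinomial random vector of $n$ trials with probabilities $(p,q,1-p-q)$. Then $$\mathbb{E}\left[\left(J(n)-J(M)\right)\left(J(n)-J(K)\right)\right]=\sum_{m=1}^n\sum_{k=1}^m\frac{(1-q)^m\left(1-\frac{p}{1-q}\right)^k+(1-p)^m\left(1-\frac{q}{1-p}\right)^k}{mk}+\sum_{m=1}^n\frac{1-(1-p)^m-(1-q)^m}{m^2}.$$
   Context: $\mathbb{N}=\{1,2,3,\dots\}$ and $J(m)=\sum_{k=1}^m 1/k$ is the $m$-th harmonic number with $J(0)=0$. *)

theory Defs
  imports "HOL-Probability.Probability"
begin

definition multinomial_mass :: "nat \<Rightarrow> real list \<Rightarrow> nat list \<Rightarrow> real" where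
  "multinomial_mass n ps xs =
     (if length xs = length ps \<and> sum_list xs = n
      then fact n / (\<Prod>i<length xs. fact (xs ! i)) * (\<Prod>i<length xs. (ps ! i) ^ (xs ! i))
      else 0)"

(* The mass of every list is prescribed, also of those that are not possible outcomes. In
   particular, for a vector [M, K, n - M - K] with truncated subtraction the event M + K > n is
   null, since there the entries do not add up to n. *)
definition multinomial_vector ::
  "'a measure \<Rightarrow> nat \<Rightarrow> real list \<Rightarrow> ('a \<Rightarrow> nat list) \<Rightarrow> bool" where
  "multinomial_vector \<Omega> n ps X \<longleftrightarrow>
     (\<forall>p \<in> set ps. 0 \<le> p) \<and> sum_list ps = 1 \<and>
     X \<in> measurable \<Omega> (count_space UNIV) \<and>
     (\<forall>xs. measure \<Omega> {\<omega> \<in> space \<Omega>. X \<omega> = xs} = multinomial_mass n ps xs)"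

end

theory Submission
  imports Defs
begin

text \<open>
  Write \<open>M\<^sub>n\<close>, \<open>K\<^sub>n\<close> for the counts after \<open>n\<close> trials, \<open>A = J n - J M\<^sub>n\<close> and \<open>B = J n - J K\<^sub>n\<close>.
  Given the counts, the last trial is by exchangeability of the first kind with probability
  \<open>M\<^sub>n / n\<close>, so the last increment of \<open>J M\<^sub>n\<close>, which is \<open>1 / M\<^sub>n\<close> on that event, has conditional mean
  \<open>1 / n\<close> on \<open>M\<^sub>n > 0\<close>. Hence the increment \<open>a\<close> of \<open>A\<close> has conditional mean
  \<open>1 / n\<close> on \<open>M\<^sub>n = 0\<close> and \<open>0\<close> elsewhere, and likewise for the increment \<open>b\<close> of \<open>B\<close>. The increment of
  \<open>A * B\<close> is \<open>a * B + b * A - a * b\<close>, and its mean is the \<open>n\<close>-th summand of the right-hand side: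
  on \<open>M\<^sub>n = 0\<close> the count \<open>K\<^sub>n\<close> is binomial, and the mean of \<open>B\<close> is found by the same argument.
\<close>

section \<open>Sums against trinomial weights\<close>

definition triples :: "nat \<Rightarrow> (nat \<times> nat \<times> nat) set" where
  "triples n = {(i, j, l). i + j + l = n}"

text \<open>For nonnegative weights of sum 1 this is an expectation. The weights are arbitrary reals
  because an event such as \<open>i = 0\<close> is later encoded by setting \<open>p = 0\<close>,
  which changes the total mass.\<close>

definition trinomial_sum ::
  "real \<Rightarrow> real \<Rightarrow> real \<Rightarrow> nat \<Rightarrow> (nat \<Rightarrow> nat \<Rightarrow> nat \<Rightarrow> real) \<Rightarrow> real" where
  "trinomial_sum p q r n f = (\<Sum>(i, j, l) \<in> triples n.
     fact n / (fact i * fact j * fact l) * (p ^ i * q ^ j * r ^ l) * f i j l)"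

lemma finite_triples [simp]: "finite (triples n)"
  by (rule finite_subset[of _ "{..n} \<times> {..n} \<times> {..n}"]) (auto simp: triples_def)

lemma trinomial_sum_0 [simp]: "trinomial_sum p q r 0 f = f 0 0 0"
proof -
  have "triples 0 = {(0, 0, 0)}"
    by (auto simp: triples_def)
  then show ?thesis
    by (simp add: trinomial_sum_def)
qed

lemma trinomial_sum_cong:
  assumes "\<And>i j l. i + j + l = n \<Longrightarrow> f i j l = g i j l"
  shows "trinomial_sum p q r n f = trinomial_sum p q r n g"
  unfolding trinomial_sum_def by (rule sum.cong) (auto simp: triples_def assms)

lemma trinomial_sum_add:
  "trinomial_sum p q r n (\<lambda>i j l. f i j l + g i j l) =
     trinomial_sum p q r n f + trinomial_sum p q r n g"
  by (simp add: trinomial_sum_def sum.distrib ring_distribs split_beta)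

lemma trinomial_sum_cmult:
  "trinomial_sum p q r n (\<lambda>i j l. c * f i j l) = c * trinomial_sum p q r n f"
  by (simp add: trinomial_sum_def sum_distrib_left split_beta mult_ac)

lemma trinomial_sum_swap12:
  "trinomial_sum p q r n f = trinomial_sum q p r n (\<lambda>i j l. f j i l)"
  unfolding trinomial_sum_def
  by (rule sum.reindex_bij_witness[of _ "\<lambda>(i, j, l). (j, i, l)" "\<lambda>(i, j, l). (j, i, l)"])
    (auto simp: triples_def mult_ac)

lemma trinomial_sum_swap13:
  "trinomial_sum p q r n f = trinomial_sum r q p n (\<lambda>i j l. f l j i)"
  unfolding trinomial_sum_def
  by (rule sum.reindex_bij_witness[of _ "\<lambda>(i, j, l). (l, j, i)" "\<lambda>(i, j, l). (l, j, i)"])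
    (auto simp: triples_def mult_ac)

section \<open>Removing one trial\<close>

lemma trinomial_mass_shift1:
  fixes p x :: real
  shows "fact (Suc n) / (fact (Suc i) * fact j * fact l) * (p ^ Suc i * y * z) * (real (Suc i) * x) =
    real (Suc n) * p * (fact n / (fact i * fact j * fact l) * (p ^ i * y * z) * x)"
  by (simp add: divide_simps del: of_nat_Suc)

text \<open>Size biasing: the factor \<open>i\<close> cancels in \<open>fact i\<close> and leaves
  \<open>Suc n * p\<close> times the weight of \<open>(i - 1, j, l)\<close>. The truncated
  \<open>i - 1\<close> at \<open>i = 0\<close> is harmless, as the factor \<open>i\<close> vanishes
  there.\<close>

lemma trinomial_sum_shift1:
  "trinomial_sum p q r (Suc n) (\<lambda>i j l. real i * f (i - 1) j l) =
     real (Suc n) * p * trinomial_sum p q r n f"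
proof -
  have "trinomial_sum p q r (Suc n) (\<lambda>i j l. real i * f (i - 1) j l) =
      (\<Sum>(i, j, l) \<in> {(i, j, l) \<in> triples (Suc n). i \<noteq> 0}.
        fact (Suc n) / (fact i * fact j * fact l) * (p ^ i * q ^ j * r ^ l)
          * (real i * f (i - 1) j l))"
    unfolding trinomial_sum_def by (rule sum.mono_neutral_right) auto
  also have "\<dots> = (\<Sum>(i, j, l) \<in> triples n. real (Suc n) * p *
      (fact n / (fact i * fact j * fact l) * (p ^ i * q ^ j * r ^ l) * f i j l))"
    by (rule sum.reindex_bij_witness[of _ "\<lambda>(i, j, l). (Suc i, j, l)" "\<lambda>(i, j, l). (i - 1, j, l)"])
      (auto simp only: triples_def trinomial_mass_shift1 gr0_conv_Suc mem_Collect_eq case_prod_conv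
        neq0_conv diff_Suc_1 add_Suc nat.inject)
  also have "\<dots> = real (Suc n) * p * trinomial_sum p q r n f"
    by (simp add: trinomial_sum_def sum_distrib_left split_beta)
  finally show ?thesis .
qed

lemma trinomial_sum_shift2:
  "trinomial_sum p q r (Suc n) (\<lambda>i j l. real j * f i (j - 1) l) =
     real (Suc n) * q * trinomial_sum p q r n f"
  using trinomial_sum_shift1[of q p r n "\<lambda>i j l. f j i l"]
  by (simp add: trinomial_sum_swap12[of p q r])

lemma trinomial_sum_shift3:
  "trinomial_sum p q r (Suc n) (\<lambda>i j l. real l * f i j (l - 1)) =
     real (Suc n) * r * trinomial_sum p q r n f"
  using trinomial_sum_shift1[of r q p n "\<lambda>i j l. f l j i"]
  by (simp add: trinomial_sum_swap13[of p q r])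

text \<open>
  By exchangeability, \<open>n\<close> trials arise from \<open>Suc n\<close> trials by deleting one chosen uniformly.
\<close>
lemma trinomial_sum_remove_trial:
  "(p + q + r) * trinomial_sum p q r n f =
     trinomial_sum p q r (Suc n) (\<lambda>i j l.
       (real i * f (i - 1) j l + real j * f i (j - 1) l + real l * f i j (l - 1)) / real (Suc n))"
proof -
  have "trinomial_sum p q r (Suc n) (\<lambda>i j l.
       (real i * f (i - 1) j l + real j * f i (j - 1) l + real l * f i j (l - 1)) / real (Suc n)) =
     1 / real (Suc n) * trinomial_sum p q r (Suc n) (\<lambda>i j l.
       (real i * f (i - 1) j l + real j * f i (j - 1) l) + real l * f i j (l - 1))"
    unfolding trinomial_sum_cmult[symmetric] by simp
  also have "\<dots> = 1 / real (Suc n) * (real (Suc n) * ((p + q + r) * trinomial_sum p q r n f))"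
    unfolding trinomial_sum_add trinomial_sum_shift1 trinomial_sum_shift2 trinomial_sum_shift3
    by (simp add: algebra_simps)
  finally show ?thesis
    by simp
qed

lemma trinomial_sum_1: "trinomial_sum p q r n (\<lambda>_ _ _. 1) = (p + q + r) ^ n"
proof (induction n)
  case (Suc n)
  \<comment> \<open>For \<open>f = 1\<close> the average over the removed trial is
    \<open>(i + j + l) / Suc n = 1\<close>.\<close>
  have "trinomial_sum p q r (Suc n) (\<lambda>_ _ _. 1) = (p + q + r) * trinomial_sum p q r n (\<lambda>_ _ _. 1)"
    unfolding trinomial_sum_remove_trial
    by (rule trinomial_sum_cong) (simp flip: of_nat_add)
  then show ?case
    by (simp add: Suc)
qed simp

text \<open>\<open>0 ^ i\<close> is the indicator of \<open>i = 0\<close>.\<close>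

lemma trinomial_sum_none1:
  "trinomial_sum p q r n (\<lambda>i j l. of_bool (i = 0) * f i j l) = trinomial_sum 0 q r n f"
  unfolding trinomial_sum_def by (rule sum.cong) auto

lemma trinomial_sum_none2:
  "trinomial_sum p q r n (\<lambda>i j l. of_bool (j = 0) * f i j l) = trinomial_sum p 0 r n f"
  unfolding trinomial_sum_def by (rule sum.cong) auto

section \<open>Harmonic numbers of the counts\<close>

lemma mult_harm_pred:
  "real i * harm (i - 1) = real i * harm i - of_bool (i \<noteq> 0)"
  \<comment> \<open>For \<open>i > 0\<close> the loss is \<open>i * (1 / i) = 1\<close>, whatever
    \<open>i\<close> is; at \<open>i = 0\<close> nothing is lost. Hence the indicators of
    \<open>i = 0\<close> below.\<close>
  by (cases i) (simp_all add: harm_Suc field_simps)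

text \<open>Removing a trial multiplies the sum for \<open>n\<close> by \<open>p + q + r\<close>,
  and the event \<open>i = 0\<close> adds \<open>(q + r) ^ Suc n / Suc n\<close>. The total mass
  stays general since the product formula needs a weight set to \<open>0\<close>.\<close>

lemma trinomial_sum_harm1:
  "trinomial_sum p q r n (\<lambda>i j l. harm n - harm i) =
     (\<Sum>k=1..n. (p + q + r) ^ (n - k) * (q + r) ^ k / real k)"
proof (induction n)
  case (Suc n)
  define c where "c = 1 / real (Suc n)"
  have J: "harm n = harm (Suc n) - c"
    by (simp add: harm_Suc c_def divide_inverse)
  have "(p + q + r) * trinomial_sum p q r n (\<lambda>i j l. harm n - harm i) =
      trinomial_sum p q r (Suc n) (\<lambda>i j l.
        (harm (Suc n) - harm i) + (- c) * (of_bool (i = 0) * 1))"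
    unfolding trinomial_sum_remove_trial
  proof (rule trinomial_sum_cong)
    fix i j l assume "i + j + l = Suc n"
    then have l: "real l = real (Suc n) - real i - real j"
      by linarith
    have *: "real i * (harm n - harm (i - 1)) = real i * (harm n - harm i) + of_bool (i \<noteq> 0)"
      using mult_harm_pred[of i] by (simp add: algebra_simps)
    have "real i * (harm n - harm (i - 1)) + real j * (harm n - harm i)
        + real l * (harm n - harm i) = real (Suc n) * (harm n - harm i) + of_bool (i \<noteq> 0)"
      unfolding * l by (simp add: algebra_simps)
    then have "(real i * (harm n - harm (i - 1)) + real j * (harm n - harm i)
        + real l * (harm n - harm i)) / real (Suc n) = (harm n - harm i) + c * of_bool (i \<noteq> 0)"
      by (simp add: c_def add_divide_distrib del: of_nat_Suc)
    also have "\<dots> = (harm (Suc n) - harm i) + (- c) * (of_bool (i = 0) * 1)"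
      by (simp add: J)
    finally show "(real i * (harm n - harm (i - 1)) + real j * (harm n - harm i)
        + real l * (harm n - harm i)) / real (Suc n) =
        (harm (Suc n) - harm i) + (- c) * (of_bool (i = 0) * 1)" .
  qed
  also have "\<dots> = trinomial_sum p q r (Suc n) (\<lambda>i j l. harm (Suc n) - harm i)
      - c * (q + r) ^ Suc n"
    unfolding trinomial_sum_add trinomial_sum_cmult trinomial_sum_none1 trinomial_sum_1 by simp
  finally have "trinomial_sum p q r (Suc n) (\<lambda>i j l. harm (Suc n) - harm i) =
      (p + q + r) * (\<Sum>k=1..n. (p + q + r) ^ (n - k) * (q + r) ^ k / real k)
        + c * (q + r) ^ Suc n"
    by (simp add: Suc)
  also have "(p + q + r) * (\<Sum>k=1..n. (p + q + r) ^ (n - k) * (q + r) ^ k / real k) =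
      (\<Sum>k=1..n. (p + q + r) ^ (Suc n - k) * (q + r) ^ k / real k)"
    unfolding sum_distrib_left by (rule sum.cong) (simp_all add: Suc_diff_le)
  finally show ?case
    by (simp add: c_def)
qed (simp add: harm_def)

lemma trinomial_sum_harm2:
  "trinomial_sum p q r n (\<lambda>i j l. harm n - harm j) =
     (\<Sum>k=1..n. (p + q + r) ^ (n - k) * (p + r) ^ k / real k)"
  using trinomial_sum_harm1[of q p r n]
  by (simp add: trinomial_sum_swap12[of p q r] add.commute)

text \<open>The last term is minus the mean product of the two increments: one trial cannot raise
  both counts, so given the counts this product has mean
  \<open>c\<^sup>2 * (of_bool (i = 0) + of_bool (j = 0) - 1)\<close>.\<close>

lemma trinomial_sum_harm_mult_harm_Suc:
  fixes n :: nat
  defines "c \<equiv> 1 / real (Suc n)"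
  assumes pqr: "p + q + r = 1"
  shows "trinomial_sum p q r (Suc n) (\<lambda>i j l. (harm (Suc n) - harm i) * (harm (Suc n) - harm j)) =
     trinomial_sum p q r n (\<lambda>i j l. (harm n - harm i) * (harm n - harm j))
     + c * trinomial_sum 0 q r (Suc n) (\<lambda>i j l. harm (Suc n) - harm j)
     + c * trinomial_sum p 0 r (Suc n) (\<lambda>i j l. harm (Suc n) - harm i)
     + c\<^sup>2 * (1 - (q + r) ^ Suc n - (p + r) ^ Suc n)"
proof -
  have J: "harm n = harm (Suc n) - c"
    by (simp add: harm_Suc c_def divide_inverse)
  have "trinomial_sum p q r n (\<lambda>i j l. (harm n - harm i) * (harm n - harm j)) =
      (p + q + r) * trinomial_sum p q r n (\<lambda>i j l. (harm n - harm i) * (harm n - harm j))"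
    by (simp add: pqr)
  also have "\<dots> = trinomial_sum p q r (Suc n) (\<lambda>i j l.
        (harm (Suc n) - harm i) * (harm (Suc n) - harm j)
        + (- c) * (of_bool (i = 0) * (harm (Suc n) - harm j))
        + (- c) * (of_bool (j = 0) * (harm (Suc n) - harm i))
        + c\<^sup>2 * (of_bool (i = 0) * 1) + c\<^sup>2 * (of_bool (j = 0) * 1) + (- c\<^sup>2) * 1)"
    unfolding trinomial_sum_remove_trial
  proof (rule trinomial_sum_cong)
    fix i j l assume "i + j + l = Suc n"
    then have l: "real l = real (Suc n) - real i - real j"
      by linarith
    \<comment> \<open>These are not the increments: \<open>a + c\<close> and \<open>b + c\<close>
      are the differences after \<open>Suc n\<close> trials.\<close>
    define a b where "a = harm n - (harm i :: real)" and "b = harm n - (harm j :: real)"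
    have i: "real i * (harm n - harm (i - 1)) = real i * a + of_bool (i \<noteq> 0)"
      using mult_harm_pred[of i] by (simp add: algebra_simps a_def)
    have j: "real j * (harm n - harm (j - 1)) = real j * b + of_bool (j \<noteq> 0)"
      using mult_harm_pred[of j] by (simp add: algebra_simps b_def)
    have "real i * ((harm n - harm (i - 1)) * b) + real j * (a * (harm n - harm (j - 1)))
        + real l * (a * b) =
        (real i * (harm n - harm (i - 1))) * b + (real j * (harm n - harm (j - 1))) * a
        + real l * (a * b)"
      by simp
    also have "\<dots> = real (Suc n) * (a * b) + of_bool (i \<noteq> 0) * b + of_bool (j \<noteq> 0) * a"
      unfolding i j l by (simp add: algebra_simps)
    finally have "(real i * ((harm n - harm (i - 1)) * b) + real j * (a * (harm n - harm (j - 1)))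
        + real l * (a * b)) / real (Suc n) =
        a * b + c * of_bool (i \<noteq> 0) * b + c * of_bool (j \<noteq> 0) * a"
      by (simp add: c_def add_divide_distrib del: of_nat_Suc)
    \<comment> \<open>Replace \<open>of_bool (i \<noteq> 0)\<close> by
      \<open>1 - of_bool (i = 0)\<close>, likewise for \<open>j\<close>, and expand in
      \<open>a + c\<close> and \<open>b + c\<close>.\<close>
    also have "\<dots> = (a + c) * (b + c)
        + (- c) * (of_bool (i = 0) * (b + c)) + (- c) * (of_bool (j = 0) * (a + c))
        + c\<^sup>2 * (of_bool (i = 0) * 1) + c\<^sup>2 * (of_bool (j = 0) * 1) + (- c\<^sup>2) * 1"
      by (simp add: of_bool_def algebra_simps power2_eq_square)
    also have "a + c = harm (Suc n) - harm i"
      by (simp add: a_def J)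
    also have "b + c = harm (Suc n) - harm j"
      by (simp add: b_def J)
    finally show "(real i * ((harm n - harm (i - 1)) * (harm n - harm j))
        + real j * ((harm n - harm i) * (harm n - harm (j - 1)))
        + real l * ((harm n - harm i) * (harm n - harm j))) / real (Suc n) =
        (harm (Suc n) - harm i) * (harm (Suc n) - harm j)
        + (- c) * (of_bool (i = 0) * (harm (Suc n) - harm j))
        + (- c) * (of_bool (j = 0) * (harm (Suc n) - harm i))
        + c\<^sup>2 * (of_bool (i = 0) * 1) + c\<^sup>2 * (of_bool (j = 0) * 1) + (- c\<^sup>2) * 1"
      by (simp only: a_def b_def)
  qed
  also have "\<dots> = trinomial_sum p q r (Suc n)
        (\<lambda>i j l. (harm (Suc n) - harm i) * (harm (Suc n) - harm j))
      - c * trinomial_sum 0 q r (Suc n) (\<lambda>i j l. harm (Suc n) - harm j)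
      - c * trinomial_sum p 0 r (Suc n) (\<lambda>i j l. harm (Suc n) - harm i)
      - c\<^sup>2 * (1 - (q + r) ^ Suc n - (p + r) ^ Suc n)"
    unfolding trinomial_sum_add trinomial_sum_cmult trinomial_sum_none1 trinomial_sum_none2
      trinomial_sum_1 pqr
    by (simp add: algebra_simps)
  finally show ?thesis
    by linarith
qed

text \<open>The recurrence is summed up. Its boundary sums are first moments with
  \<open>p = 0\<close> or \<open>q = 0\<close>, whence the powers of \<open>r\<close> and the inner
  sum.\<close>

lemma trinomial_sum_harm_mult_harm:
  assumes "p + q + r = 1"
  shows "trinomial_sum p q r n (\<lambda>i j l. (harm n - harm i) * (harm n - harm j)) =
    (\<Sum>m=1..n. \<Sum>k=1..m.
        ((p + r) ^ (m - k) * r ^ k + (q + r) ^ (m - k) * r ^ k) / (real m * real k))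
    + (\<Sum>m=1..n. (1 - (q + r) ^ m - (p + r) ^ m) / (real m)\<^sup>2)"
proof (induction n)
  case (Suc n)
  have "1 / real (Suc n) * (\<Sum>k=1..Suc n. (q + r) ^ (Suc n - k) * r ^ k / real k)
      + 1 / real (Suc n) * (\<Sum>k=1..Suc n. (p + r) ^ (Suc n - k) * r ^ k / real k) =
      (\<Sum>k=1..Suc n. ((p + r) ^ (Suc n - k) * r ^ k + (q + r) ^ (Suc n - k) * r ^ k)
        / (real (Suc n) * real k))"
    unfolding sum_distrib_left sum.distrib[symmetric]
    by (rule sum.cong) (simp_all add: add_divide_distrib del: of_nat_Suc)
  then show ?case
    unfolding trinomial_sum_harm_mult_harm_Suc[OF assms] Suc.IH trinomial_sum_harm1
      trinomial_sum_harm2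
    by (simp add: power_one_over divide_inverse power_inverse algebra_simps del: power_Suc of_nat_Suc)
qed simp

section \<open>From the random vector to the finite sum\<close>

lemma multinomial_mass_triple:
  "multinomial_mass n [p, q, r] [i, j, l] =
     (if i + j + l = n then fact n / (fact i * fact j * fact l) * (p ^ i * q ^ j * r ^ l) else 0)"
  by (simp add: multinomial_mass_def lessThan_Suc eval_nat_numeral add_ac mult_ac)

text \<open>The law is given by point masses only. Those on the finite set \<open>S\<close> add up
  to 1, so \<open>X\<close> lies in \<open>S\<close> almost surely and the expectation is a finite
  sum.\<close>

lemma (in prob_space) expectation_multinomial_triple:
  fixes X :: "'a \<Rightarrow> nat list"
  assumes X: "multinomial_vector M n [p, q, r] X"
  shows "expectation (\<lambda>\<omega>. g (X \<omega>)) = trinomial_sum p q r n (\<lambda>i j l. g [i, j, l])"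
proof -
  have [measurable]: "X \<in> measurable M (count_space UNIV)"
    and pqr: "p + q + r = 1"
    and mass: "\<And>xs. prob {\<omega> \<in> space M. X \<omega> = xs} = multinomial_mass n [p, q, r] xs"
    using X by (auto simp: multinomial_vector_def)
  define S where "S = (\<lambda>(i, j, l). [i, j, l]) ` triples n"
  have S [simp]: "finite S"
    by (simp add: S_def)
  have inj: "inj_on (\<lambda>(i, j, l). [i, j, l]) (triples n)"
    by (auto simp: inj_on_def)
  have sum_S: "(\<Sum>xs\<in>S. h xs * prob {\<omega> \<in> space M. X \<omega> = xs}) =
      trinomial_sum p q r n (\<lambda>i j l. h [i, j, l])" for h
    unfolding S_def trinomial_sum_def sum.reindex[OF inj] mass
    by (rule sum.cong) (auto simp: multinomial_mass_triple triples_def)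
  have "prob {\<omega> \<in> space M. X \<omega> \<in> S} = (\<Sum>xs\<in>S. prob {\<omega> \<in> space M. X \<omega> = xs})"
  proof -
    have *: "{\<omega> \<in> space M. X \<omega> \<in> S} = (\<Union>xs\<in>S. {\<omega> \<in> space M. X \<omega> = xs})"
      by auto
    show ?thesis
      unfolding * by (rule finite_measure_finite_Union) (auto simp: disjoint_family_on_def)
  qed
  also have "\<dots> = 1"
    using sum_S[of "\<lambda>_. 1"] by (simp add: trinomial_sum_1 pqr)
  finally have AE: "AE \<omega> in M. X \<omega> \<in> S"
    by (subst (asm) prob_Collect_eq_1) auto
  have "expectation (\<lambda>\<omega>. g (X \<omega>)) =
      expectation (\<lambda>\<omega>. \<Sum>xs\<in>S. g xs * indicator {\<omega> \<in> space M. X \<omega> = xs} \<omega>)"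
  proof (rule integral_cong_AE)
    show "AE \<omega> in M. g (X \<omega>) = (\<Sum>xs\<in>S. g xs * indicator {\<omega> \<in> space M. X \<omega> = xs} \<omega>)"
      using AE AE_space
    proof eventually_elim
      case (elim \<omega>)
      then have "(\<Sum>xs\<in>S. g xs * indicator {\<omega> \<in> space M. X \<omega> = xs} \<omega>) =
          (\<Sum>xs\<in>S. if xs = X \<omega> then g xs else 0)"
        by (intro sum.cong) auto
      then show ?case
        using elim by simp
    qed
  qed measurable
  also have "\<dots> = (\<Sum>xs\<in>S. g xs * prob {\<omega> \<in> space M. X \<omega> = xs})"
    by (subst Bochner_Integration.integral_sum) (auto simp: emeasure_eq_measure)
  finally show ?thesis
    by (simp add: sum_S)
qed

theorem propositionB5:
  fixes p q :: real and n :: nat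
    and \<Omega> :: "'a measure" and M K :: "'a \<Rightarrow> nat"
  assumes "p \<in> {0<..<1}" and "q \<in> {0<..<1}" and "p + q \<le> 1" and "n \<ge> 1"
    and "prob_space \<Omega>"
    and "multinomial_vector \<Omega> n [p, q, 1 - p - q] (\<lambda>\<omega>. [M \<omega>, K \<omega>, n - M \<omega> - K \<omega>])"
  shows "prob_space.expectation \<Omega> (\<lambda>\<omega>. (harm n - harm (M \<omega>)) * (harm n - harm (K \<omega>))) =
    (\<Sum>m=1..n. \<Sum>k=1..m.
        ((1 - q) ^ m * (1 - p / (1 - q)) ^ k + (1 - p) ^ m * (1 - q / (1 - p)) ^ k)
          / (real m * real k))
    + (\<Sum>m=1..n. (1 - (1 - p) ^ m - (1 - q) ^ m) / (real m)\<^sup>2)"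
proof -
  \<comment> \<open>Used with \<open>s = 1 - q\<close>, \<open>t = p\<close> and with
    \<open>s = 1 - p\<close>, \<open>t = q\<close>; in both cases \<open>s - t\<close> is the third
    weight.\<close>
  have split_power: "s ^ m * (1 - t / s) ^ k = s ^ (m - k) * (s - t) ^ k"
    if "s > 0" "k \<le> m" for s t :: real and m k :: nat
  proof -
    have "s ^ m * (1 - t / s) ^ k = s ^ (m - k) * (s * (1 - t / s)) ^ k"
      using that by (simp add: power_mult_distrib flip: power_add mult.assoc)
    also have "s * (1 - t / s) = s - t"
      using that by (simp add: field_simps)
    finally show ?thesis .
  qed
  have "prob_space.expectation \<Omega> (\<lambda>\<omega>. (harm n - harm (M \<omega>)) * (harm n - harm (K \<omega>))) =
      trinomial_sum p q (1 - p - q) n (\<lambda>i j l. (harm n - harm i) * (harm n - harm j))"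
    \<comment> \<open>The integrand reads only the first two entries, so the truncated third one
      never enters it.\<close>
    using prob_space.expectation_multinomial_triple[OF assms(5,6),
        of "\<lambda>xs. (harm n - harm (xs ! 0)) * (harm n - harm (xs ! 1))"]
    by simp
  also have "\<dots> = (\<Sum>m=1..n. \<Sum>k=1..m.
        ((1 - q) ^ (m - k) * (1 - p - q) ^ k + (1 - p) ^ (m - k) * (1 - p - q) ^ k)
          / (real m * real k))
      + (\<Sum>m=1..n. (1 - (1 - p) ^ m - (1 - q) ^ m) / (real m)\<^sup>2)"
    by (subst trinomial_sum_harm_mult_harm) simp_all
  also have "(\<Sum>m=1..n. \<Sum>k=1..m.
        ((1 - q) ^ (m - k) * (1 - p - q) ^ k + (1 - p) ^ (m - k) * (1 - p - q) ^ k)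
          / (real m * real k)) =
      (\<Sum>m=1..n. \<Sum>k=1..m.
        ((1 - q) ^ m * (1 - p / (1 - q)) ^ k + (1 - p) ^ m * (1 - q / (1 - p)) ^ k)
          / (real m * real k))"
    using assms(1,2) by (intro sum.cong refl) (simp add: split_power algebra_simps)
  finally show ?thesis .
qed

end
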